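(* The generating function $I(y,z)\equiv I(x;y,z)=\sum_{h,k\geq 1}I_{h,k}\,y^hz^k$, where $I_{h,k}\equiv I_{h,k}(x)$ is the size generating function (in the variable $x$) of strong-Baxter permutations having label $(h,k)$, satisfies $$I(y,z)=xyz+\frac{x}{1-y}\bigl(y\,I(1,z)-I(y,z)\bigr)+xz\,I(y,z)+\frac{xyz}{1-z}\bigl(I(y,1)-I(y,z)\bigr).$$
   Context: A permutation $\pi=\pi_1\cdots\pi_n$ of $\{1,\dots,n\}$ is strong-Baxter if there are no indices $i<j$ and $k>j+1$ satisfying any of the following: $\pi_{j+1}<\pi_i<\pi_k<\pi_j$; $\pi_j<\pi_k<\pi_i<\pi_{j+1}$; $\pi_{j+1}<\pi_k<\pi_i<\pi_j$. For a permutation $\pi$ of size $n$ and $a\in\{1,\dots,n+1\}$, $\pi\cdot a$ is the permutation $\pi'$ of size $n+1$ with $\pi'_{n+1}=a$ and, for $i\leq n$, $\pi'_i=\pi_i$ if $\pi_i<a$ and $\pi'_i=\pi_i+1$ if $\pi_i\geq a$. The active sites of a strong-Baxter permutation $\pi$ of size $n$ are the values $a\in\{1,\dots,n+1\}$ such that $\pi\cdot a$ is strong-Baxter. The label of $\pi$ is $(h,k)$, where $h$ (resp. $k$) is the number of active sites $a$ of $\pi$ with $a\leq\pi_n$ (resp. $a>\pi_n$). $I_{h,k}(x)=\sum_\pi x^{|\pi|}$, the sum being over strong-Baxter permutations $\pi$ (of size $|\pi|\geq 1$) with label $(h,k)$. $I(y,z)$ is a formal power series in $x$ with polynomial coefficients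 in $y,z$. *)

theory Defs
  imports
    "HOL-Computational_Algebra.Computational_Algebra"
    "HOL-Combinatorics.Multiset_Permutations"
begin

text \<open>
  A permutation of \<open>{1..n}\<close> is the word of its values, an element of
  \<^term>\<open>permutations_of_set {1..n}\<close>. Positions in a list start at 0, so
  \<open>\<pi>\<^sub>i\<close> is \<open>\<pi> ! (i - 1)\<close>; the conditions on positions below are invariant under this shift.
\<close>

definition strong_Baxter :: "nat list \<Rightarrow> bool" where
  "strong_Baxter \<pi> \<longleftrightarrow>
     \<pi> \<in> permutations_of_set {1..length \<pi>} \<and>
     \<not> (\<exists>i j k. i < j \<and> j + 1 < k \<and> k < length \<pi> \<and>
          (\<pi> ! (j+1) < \<pi> ! i \<and> \<pi> ! i < \<pi> ! k \<and> \<pi> ! k < \<pi> ! j \<or>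
           \<pi> ! j < \<pi> ! k \<and> \<pi> ! k < \<pi> ! i \<and> \<pi> ! i < \<pi> ! (j+1) \<or>
           \<pi> ! (j+1) < \<pi> ! k \<and> \<pi> ! k < \<pi> ! i \<and> \<pi> ! i < \<pi> ! j))"

definition append_value :: "nat list \<Rightarrow> nat \<Rightarrow> nat list" where
  "append_value \<pi> a = map (\<lambda>v. if v < a then v else v + 1) \<pi> @ [a]"

definition active_sites :: "nat list \<Rightarrow> nat set" where
  "active_sites \<pi> = {a \<in> {1..length \<pi> + 1}. strong_Baxter (append_value \<pi> a)}"

definition label :: "nat list \<Rightarrow> nat \<times> nat" where
  "label \<pi> = (card {a \<in> active_sites \<pi>. a \<le> last \<pi>}, card {a \<in> active_sites \<pi>. a > last \<pi>})"

definition label_gf :: "nat \<Rightarrow> nat \<Rightarrow> nat fps" where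
  "label_gf h k =
     Abs_fps (\<lambda>n. card {\<pi>. strong_Baxter \<pi> \<and> \<pi> \<noteq> [] \<and> length \<pi> = n \<and> label \<pi> = (h, k)})"

text \<open>
  The series \<open>I(y, z)\<close>. Its coefficient at \<open>x\<^sup>n\<close> is the sum of
  \<open>(label_gf h k $ n) y\<^sup>h z\<^sup>k\<close> over all \<open>h, k \<ge> 1\<close>, restricted to the nonzero summands. There
  are finitely many of those (lemma \<open>finite_label_gf_support\<close>), so the coefficient is a polynomial
  in \<open>y\<close> and \<open>z\<close>. The arguments are elements of an arbitrary commutative semiring: at the two
  indeterminates this is \<open>I(y, z)\<close> itself, and replacing one of them by 1 is the substitution in
  \<open>I(1, z)\<close> and \<open>I(y, 1)\<close>.
\<close>

definition strong_Baxter_gf :: "'a::comm_semiring_1 \<Rightarrow> 'a \<Rightarrow> 'a fps" where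
  "strong_Baxter_gf y z =
     Abs_fps (\<lambda>n. \<Sum>(h, k) \<in> {(h, k). h \<ge> 1 \<and> k \<ge> 1 \<and> label_gf h k $ n \<noteq> 0}.
                    of_nat (label_gf h k $ n) * y ^ h * z ^ k)"

lemma card_active_sites_le: "card {a \<in> active_sites \<pi>. P a} \<le> length \<pi> + 1"
proof -
  have "card {a \<in> active_sites \<pi>. P a} \<le> card {1..length \<pi> + 1}"
    by (intro card_mono) (auto simp: active_sites_def)
  then show ?thesis by simp
qed

lemma finite_label_gf_support:
  "finite {(h, k). h \<ge> 1 \<and> k \<ge> 1 \<and> label_gf h k $ n \<noteq> 0}"
proof (rule finite_subset)
  show "{(h, k). h \<ge> 1 \<and> k \<ge> 1 \<and> label_gf h k $ n \<noteq> 0} \<subseteq> {..n+1} \<times> {..n+1}"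
  proof (rule subrelI)
    fix h k assume "(h, k) \<in> {(h, k). h \<ge> 1 \<and> k \<ge> 1 \<and> label_gf h k $ n \<noteq> 0}"
    then have "label_gf h k $ n \<noteq> 0" by simp
    then have "{\<pi>. strong_Baxter \<pi> \<and> \<pi> \<noteq> [] \<and> length \<pi> = n \<and> label \<pi> = (h, k)} \<noteq> {}"
      by (auto simp: label_gf_def simp del: Collect_empty_eq)
    then obtain \<pi> where \<pi>: "length \<pi> = n" "label \<pi> = (h, k)" by blast
    then have "h = card {a \<in> active_sites \<pi>. a \<le> last \<pi>}"
      "k = card {a \<in> active_sites \<pi>. a > last \<pi>}"
      by (simp_all add: label_def)
    with card_active_sites_le[of \<pi>] \<pi>(1) show "(h, k) \<in> {..n+1} \<times> {..n+1}"
      by auto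
  qed
qed simp

text \<open>
  The indeterminates of \<open>\<int>[y][z]\<close>, realised as \<^typ>\<open>int poly poly\<close> with \<open>y\<close> the
  variable of the inner and \<open>z\<close> that of the outer polynomial ring.
\<close>

definition var_y :: "int poly poly" where
  "var_y = [:[:0, 1:]:]"

definition var_z :: "int poly poly" where
  "var_z = [:0, 1:]"

end

theory Submission
  imports Defs
begin

text \<open>
  Deleting the last entry of a strong-Baxter permutation and closing the gap in the values leaves a
  strong-Baxter permutation, since no pattern occurrence is created. So every strong-Baxter
  permutation of size \<open>n + 1\<close> arises exactly once as \<open>\<pi> \<cdot> a\<close> from a strong-Baxter permutation \<open>\<pi>\<close> of
  size \<open>n\<close> and an active site \<open>a\<close> of \<open>\<pi>\<close>, and the generating function is determined once the labels of
  the children \<open>\<pi> \<cdot> a\<close> are known.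

  A site is inactive when some pair of adjacent entries, together with an entry before the pair,
  forms a forbidden pattern with the new last entry; such a site is called blocked. Appending \<open>a\<close>
  creates one new adjacent pair, \<open>(last \<pi>, a)\<close>. All values between its two entries occur earlier
  in \<open>\<pi>\<close>, so the effect of the pair is easy to describe (\<open>blocked_append_value_iff\<close>). A descent
  that skips a value blocks every site above \<open>a\<close> and up to the old last entry; an ascent
  blocks the sites strictly between the old last entry and \<open>a\<close>. If \<open>a\<close> is \<open>last \<pi>\<close>, nothing is
  blocked and the site \<open>a\<close> splits into two active sites. Counting the surviving sites shows that a
  permutation with label \<open>(h, k)\<close> has children with labels (\<open>sum_active_sites_label\<close>)
  \<open>(1, k), \<dots>, (h - 1, k)\<close>, then \<open>(h, k + 1)\<close>, then \<open>(h + 1, 1), \<dots>, (h + 1, k)\<close>.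

  In terms of monomials the children contribute
  \<open>(y - y^h) z^k / (1 - y) + y^h z^(k + 1) + y^(h + 1) (z - z^(k + 1)) / (1 - z)\<close>
  by summing the geometric progressions. Every term is \<open>y^h z^k\<close> with one of its variables possibly
  set to 1, times a factor that does not depend on \<open>h\<close> and \<open>k\<close>. Summation over all \<open>\<pi>\<close> therefore
  gives a functional equation, which holds over every commutative ring after multiplication by
  \<open>(1 - y) (1 - z)\<close> (\<open>strong_Baxter_gf_functional_equation\<close>).
\<close>

section \<open>Appending a value to a permutation\<close>

definition shift_up :: "nat \<Rightarrow> nat \<Rightarrow> nat" where
  "shift_up a v = (if v < a then v else v + 1)"

text \<open>
  Sites are the gaps between values. Appending \<open>a\<close> splits the gap \<open>a\<close> into the gaps \<open>a\<close> and \<open>a + 1\<close>,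
  and this function maps each gap to the one it comes from. It is adjoint to \<open>shift_up\<close>: comparing a
  shifted value with a site amounts to comparing the original value with the parent site.
\<close>

definition parent_site :: "nat \<Rightarrow> nat \<Rightarrow> nat" where
  "parent_site a b = (if b \<le> a then b else b - 1)"

lemma shift_up_less_iff [simp]: "shift_up a u < shift_up a v \<longleftrightarrow> u < v"
  and shift_up_less_site_iff: "shift_up a v < b \<longleftrightarrow> v < parent_site a b"
  and site_le_shift_up_iff: "b \<le> shift_up a v \<longleftrightarrow> parent_site a b \<le> v"
  and shift_up_less_self [simp]: "shift_up a v < a \<longleftrightarrow> v < a"
  and self_less_shift_up [simp]: "a < shift_up a v \<longleftrightarrow> a \<le> v"
  and shift_up_neq_self [simp]: "shift_up a v \<noteq> a"
  by (auto simp: shift_up_def parent_site_def)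

lemma length_append_value [simp]: "length (append_value \<pi> a) = length \<pi> + 1"
  and last_append_value [simp]: "last (append_value \<pi> a) = a"
  and append_value_not_Nil [simp]: "append_value \<pi> a \<noteq> []"
  by (simp_all add: append_value_def)

lemma nth_append_value:
  "i < length \<pi> \<Longrightarrow> append_value \<pi> a ! i = shift_up a (\<pi> ! i)"
  "append_value \<pi> a ! length \<pi> = a"
  by (simp_all add: append_value_def shift_up_def nth_append)

lemma inj_shift_up: "inj (shift_up a)"
  by (rule injI) (auto simp: shift_up_def split: if_splits)

lemma append_value_eq_shift_up: "append_value \<pi> a = map (shift_up a) \<pi> @ [a]"
  by (simp add: append_value_def shift_up_def)

lemma append_value_inject: "append_value \<pi> a = append_value \<rho> b \<longleftrightarrow> \<pi> = \<rho> \<and> a = b"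
  using inj_shift_up[of b] by (auto simp: append_value_eq_shift_up inj_map_eq_map)

lemma shift_up_image_interval:
  assumes "a \<in> {1..n + 1}"
  shows "insert a (shift_up a ` {1..n}) = {1..n + 1}"
proof -
  have "v \<in> insert a (shift_up a ` {1..n})" if v: "v \<in> {1..n + 1}" for v
  proof (cases "v < a")
    case True
    then have "v = shift_up a v" "v \<in> {1..n}" using v assms by (auto simp: shift_up_def)
    then show ?thesis by blast
  next
    case False
    show ?thesis
    proof (cases "v = a")
      case False
      then have "v = shift_up a (v - 1)" "v - 1 \<in> {1..n}"
        using v assms \<open>\<not> v < a\<close> by (auto simp: shift_up_def)
      then show ?thesis by blast
    qed simp
  qed
  moreover have "shift_up a v \<in> {1..n + 1}" if "v \<in> {1..n}" for v
    using that by (auto simp: shift_up_def)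
  ultimately show ?thesis using assms by blast
qed

lemma append_value_permutation_iff:
  assumes a: "a \<in> {1..length \<pi> + 1}"
  shows "append_value \<pi> a \<in> permutations_of_set {1..length \<pi> + 1} \<longleftrightarrow>
         \<pi> \<in> permutations_of_set {1..length \<pi>}"
proof -
  have "insert a (shift_up a ` set \<pi>) = {1..length \<pi> + 1} \<longleftrightarrow> set \<pi> = {1..length \<pi>}"
  proof
    assume "insert a (shift_up a ` set \<pi>) = {1..length \<pi> + 1}"
    with shift_up_image_interval[OF a]
    have "insert a (shift_up a ` set \<pi>) = insert a (shift_up a ` {1..length \<pi>})" by simp
    moreover have "a \<notin> shift_up a ` X" for X
      using shift_up_neq_self by (metis imageE)
    ultimately have "shift_up a ` set \<pi> = shift_up a ` {1..length \<pi>}"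
      by (metis insert_ident)
    then show "set \<pi> = {1..length \<pi>}" using inj_shift_up by (simp add: inj_image_eq_iff)
  qed (use shift_up_image_interval[OF a] in simp)
  moreover have "a \<notin> shift_up a ` X" for X
    using shift_up_neq_self by (metis imageE)
  ultimately show ?thesis
    by (auto simp: permutations_of_set_def append_value_eq_shift_up distinct_map
        intro: inj_on_subset[OF inj_shift_up])
qed

lemma permutation_eq_append_value:
  assumes "\<sigma> \<in> permutations_of_set {1..length \<sigma>}" "\<sigma> \<noteq> []"
  obtains \<pi> a where "\<sigma> = append_value \<pi> a" "a \<in> {1..length \<pi> + 1}"
proof -
  define a where "a = last \<sigma>"
  define \<pi> where "\<pi> = map (\<lambda>v. if v < a then v else v - 1) (butlast \<sigma>)"
  have \<sigma>: "butlast \<sigma> @ [a] = \<sigma>" using assms(2) by (simp add: a_def)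
  have "distinct (butlast \<sigma> @ [a])" using assms(1) by (simp only: \<sigma> permutations_of_setD)
  then have "a \<notin> set (butlast \<sigma>)" by simp
  have "shift_up a (if v < a then v else v - 1) = v" if "v \<in> set (butlast \<sigma>)" for v
    using that \<open>a \<notin> set (butlast \<sigma>)\<close> by (cases v a rule: linorder_cases) (auto simp: shift_up_def)
  then have "map (shift_up a) \<pi> = butlast \<sigma>"
    unfolding \<pi>_def map_map by (intro map_idI) simp
  then have "\<sigma> = append_value \<pi> a" using \<sigma> by (simp add: append_value_eq_shift_up)
  moreover have "a \<in> {1..length \<sigma>}"
    using assms last_in_set[OF assms(2)] by (simp add: a_def permutations_of_setD)
  ultimately show thesis using that by simp
qed

section \<open>Blocked sites\<close>

text \<open>
  The three lines are the forbidden patterns with the last entry \<open>k\<close> placed in the site \<open>a\<close>: an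
  entry \<open>v\<close> lies below the new entry when \<open>v < a\<close>, and above it when \<open>a \<le> v\<close>.
\<close>

definition blocked :: "nat list \<Rightarrow> nat \<Rightarrow> bool" where
  "blocked \<pi> a \<longleftrightarrow> (\<exists>i j. i < j \<and> j + 1 < length \<pi> \<and>
     (\<pi> ! (j+1) < \<pi> ! i \<and> \<pi> ! i < a \<and> a \<le> \<pi> ! j \<or>
      \<pi> ! j < a \<and> a \<le> \<pi> ! i \<and> \<pi> ! i < \<pi> ! (j+1) \<or>
      \<pi> ! (j+1) < a \<and> a \<le> \<pi> ! i \<and> \<pi> ! i < \<pi> ! j))"

text \<open>
  The occurrences of forbidden patterns in \<open>\<pi> \<cdot> a\<close> that avoid the last entry are those of \<open>\<pi>\<close>, because
  shifting values preserves their order; those that use the last entry witness that \<open>a\<close> is blocked.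
\<close>

lemma strong_Baxter_append_value_iff:
  assumes a: "a \<in> {1..length \<pi> + 1}"
  shows "strong_Baxter (append_value \<pi> a) \<longleftrightarrow> strong_Baxter \<pi> \<and> \<not> blocked \<pi> a"
proof -
  define B where "B \<rho> i j k \<longleftrightarrow>
          (\<rho> ! (j+1) < \<rho> ! i \<and> \<rho> ! i < \<rho> ! k \<and> \<rho> ! k < \<rho> ! j \<or>
           \<rho> ! j < \<rho> ! k \<and> \<rho> ! k < \<rho> ! i \<and> \<rho> ! i < \<rho> ! (j+1) \<or>
           \<rho> ! (j+1) < \<rho> ! k \<and> \<rho> ! k < \<rho> ! i \<and> \<rho> ! i < \<rho> ! j)" for \<rho> :: "nat list" and i j k
  let ?n = "length \<pi>"
  let ?\<sigma> = "append_value \<pi> a"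
  have old: "B ?\<sigma> i j k \<longleftrightarrow> B \<pi> i j k" if "i < j" "j + 1 < k" "k < ?n" for i j k
    using that by (simp add: B_def nth_append_value)
  have new: "B ?\<sigma> i j ?n \<longleftrightarrow>
     (\<pi> ! (j+1) < \<pi> ! i \<and> \<pi> ! i < a \<and> a \<le> \<pi> ! j \<or>
      \<pi> ! j < a \<and> a \<le> \<pi> ! i \<and> \<pi> ! i < \<pi> ! (j+1) \<or>
      \<pi> ! (j+1) < a \<and> a \<le> \<pi> ! i \<and> \<pi> ! i < \<pi> ! j)" if "i < j" "j + 1 < ?n" for i j
    using that by (simp add: B_def nth_append_value)
  have "(\<exists>i j k. i < j \<and> j + 1 < k \<and> k < ?n + 1 \<and> B ?\<sigma> i j k) \<longleftrightarrow>
        (\<exists>i j k. i < j \<and> j + 1 < k \<and> k < ?n \<and> B ?\<sigma> i j k) \<or>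
        (\<exists>i j. i < j \<and> j + 1 < ?n \<and> B ?\<sigma> i j ?n)"
    by (metis Suc_eq_plus1 less_Suc_eq)
  also have "\<dots> \<longleftrightarrow> (\<exists>i j k. i < j \<and> j + 1 < k \<and> k < ?n \<and> B \<pi> i j k) \<or> blocked \<pi> a"
  proof -
    have "(\<exists>i j. i < j \<and> j + 1 < ?n \<and> B ?\<sigma> i j ?n) \<longleftrightarrow> blocked \<pi> a"
      unfolding blocked_def using new by (intro ex_cong1 conj_cong refl) simp
    moreover have "(\<exists>i j k. i < j \<and> j + 1 < k \<and> k < ?n \<and> B ?\<sigma> i j k) \<longleftrightarrow>
        (\<exists>i j k. i < j \<and> j + 1 < k \<and> k < ?n \<and> B \<pi> i j k)"
      using old by (intro ex_cong1 conj_cong refl) simp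
    ultimately show ?thesis by (rule arg_cong2[where f = "(\<or>)", rotated])
  qed
  finally show ?thesis
    unfolding strong_Baxter_def length_append_value append_value_permutation_iff[OF a] B_def
    by simp
qed

lemma active_sites_eq:
  assumes "strong_Baxter \<pi>"
  shows "active_sites \<pi> = {a \<in> {1..length \<pi> + 1}. \<not> blocked \<pi> a}"
  using assms strong_Baxter_append_value_iff by (auto simp: active_sites_def)

text \<open>
  The old adjacent pairs block the sites whose parent they blocked in \<open>\<pi>\<close>. The new pair
  \<open>(last \<pi>, a)\<close> is completed to a pattern by an entry with a value between the two. In a descent
  any such entry blocks all sites in between, being part of 2-41-3 or of 3-41-2 according to the
  side of the new entry on which it lies. In an ascent only 3-14-2 applies: an
  intermediate entry blocks the sites above \<open>last \<pi>\<close> and up to its own value, and \<open>a - 1\<close> is the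
  greatest such value.
\<close>

lemma blocked_append_value_iff:
  assumes perm: "\<pi> \<in> permutations_of_set {1..length \<pi>}" and ne: "\<pi> \<noteq> []"
    and a: "a \<in> {1..length \<pi> + 1}"
  shows "blocked (append_value \<pi> a) b \<longleftrightarrow>
           blocked \<pi> (parent_site a b) \<or>
           a < last \<pi> \<and> a < b \<and> b \<le> last \<pi> + 1 \<or>
           last \<pi> < b \<and> b < a"
proof -
  let ?n = "length \<pi>" and ?\<sigma> = "append_value \<pi> a" and ?l = "last \<pi>"
  define C where "C \<rho> i j c \<longleftrightarrow>
     (\<rho> ! (j+1) < \<rho> ! i \<and> \<rho> ! i < c \<and> c \<le> \<rho> ! j \<or>
      \<rho> ! j < c \<and> c \<le> \<rho> ! i \<and> \<rho> ! i < \<rho> ! (j+1) \<or>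
      \<rho> ! (j+1) < c \<and> c \<le> \<rho> ! i \<and> \<rho> ! i < \<rho> ! j)" for \<rho> :: "nat list" and i j c
  have set: "set \<pi> = {1..?n}" using perm by (rule permutations_of_setD)
  have l: "?l = \<pi> ! (?n - 1)" using ne by (rule last_conv_nth)
  have earlier: "\<exists>i < ?n - 1. \<pi> ! i = v" if "v \<in> {1..?n}" "v \<noteq> ?l" for v
  proof -
    obtain i where i: "i < ?n" "\<pi> ! i = v" using \<open>v \<in> {1..?n}\<close> set by (metis in_set_conv_nth)
    then have "i \<noteq> ?n - 1" using that l by auto
    with i show ?thesis by (intro exI[of _ i]) auto
  qed
  have l_mem: "?l \<in> {1..?n}" using set last_in_set[OF ne] by simp
  have old: "C ?\<sigma> i j b \<longleftrightarrow> C \<pi> i j (parent_site a b)" if "i < j" "j + 1 < ?n" for i j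
    using that by (simp add: C_def nth_append_value)
      (simp only: shift_up_less_site_iff site_le_shift_up_iff)
  have "?n \<ge> 1" using ne by (cases \<pi>) auto
  have last_pair: "C ?\<sigma> i (?n - 1) b \<longleftrightarrow>
      (a \<le> \<pi> ! i \<and> shift_up a (\<pi> ! i) < b \<and> b \<le> shift_up a ?l \<or>
       shift_up a ?l < b \<and> b \<le> shift_up a (\<pi> ! i) \<and> \<pi> ! i < a \<or>
       a < b \<and> b \<le> shift_up a (\<pi> ! i) \<and> \<pi> ! i < ?l)"  if "i < ?n - 1" for i
  proof -
    have "?\<sigma> ! (?n - 1 + 1) = a"
      using \<open>?n \<ge> 1\<close> by (simp only: le_add_diff_inverse2 nth_append_value(2))
    then show ?thesis using that \<open>?n \<ge> 1\<close> unfolding C_def by (simp add: nth_append_value(1) l)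
  qed
  have new: "(\<exists>i < ?n - 1. C ?\<sigma> i (?n - 1) b) \<longleftrightarrow>
      a < ?l \<and> a < b \<and> b \<le> ?l + 1 \<or> ?l < b \<and> b < a" (is "?L \<longleftrightarrow> ?R")
  proof
    assume ?L
    then obtain i where "i < ?n - 1" "C ?\<sigma> i (?n - 1) b" by blast
    then show ?R
      unfolding last_pair[OF \<open>i < ?n - 1\<close>] by (auto simp: shift_up_def split: if_splits)
  next
    assume ?R
    \<comment> \<open>For a descent the entry \<open>a\<close> completes the pattern, for an ascent the entry \<open>b\<close>.\<close>
    then show ?L
    proof
      assume *: "a < ?l \<and> a < b \<and> b \<le> ?l + 1"
      then obtain i where "i < ?n - 1" "\<pi> ! i = a" using earlier[of a] a l_mem by auto
      then show ?L using * last_pair[of i] by (intro exI[of _ i]) (auto simp: shift_up_def)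
    next
      assume *: "?l < b \<and> b < a"
      then obtain i where "i < ?n - 1" "\<pi> ! i = b" using earlier[of b] a l_mem by auto
      then show ?L using * last_pair[of i] by (intro exI[of _ i]) (auto simp: shift_up_def)
    qed
  qed
  have "blocked ?\<sigma> b \<longleftrightarrow> (\<exists>i j. i < j \<and> j < ?n \<and> C ?\<sigma> i j b)"
    unfolding blocked_def C_def by simp
  also have "\<dots> \<longleftrightarrow> (\<exists>i j. i < j \<and> j + 1 < ?n \<and> C ?\<sigma> i j b) \<or> (\<exists>i < ?n - 1. C ?\<sigma> i (?n - 1) b)"
  proof -
    have "j < ?n \<longleftrightarrow> j + 1 < ?n \<or> j = ?n - 1" for j using \<open>?n \<ge> 1\<close> by auto
    then show ?thesis by metis
  qed
  also have "(\<exists>i j. i < j \<and> j + 1 < ?n \<and> C ?\<sigma> i j b) \<longleftrightarrow> blocked \<pi> (parent_site a b)"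
    unfolding blocked_def C_def[symmetric] using old by (intro ex_cong1 conj_cong refl) blast
  finally show ?thesis using new by blast
qed

lemma strong_Baxter_nth_interval:
  assumes "strong_Baxter \<pi>" "i < length \<pi>"
  shows "\<pi> ! i \<in> {1..length \<pi>}"
proof -
  have "set \<pi> = {1..length \<pi>}"
    using assms(1) unfolding strong_Baxter_def permutations_of_set_def by blast
  with nth_mem[OF assms(2)] show ?thesis by simp
qed

section \<open>Active sites and labels of the children\<close>

text \<open>
  The extreme sites cannot be blocked, since in every forbidden pattern the last entry lies strictly
  between two others. They make both components of a label positive.
\<close>

lemma one_mem_active_sites:
  assumes sb: "strong_Baxter \<pi>"
  shows "1 \<in> active_sites \<pi>"
proof -
  have "\<not> \<pi> ! i < 1" if "i < length \<pi>" for i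
    using strong_Baxter_nth_interval[OF sb that] by simp
  then have "\<not> blocked \<pi> 1"
    unfolding blocked_def by (metis add_lessD1 less_trans not_less_iff_gr_or_eq not_le)
  with sb show ?thesis by (simp add: active_sites_eq)
qed

lemma Suc_length_mem_active_sites:
  assumes sb: "strong_Baxter \<pi>"
  shows "length \<pi> + 1 \<in> active_sites \<pi>"
proof -
  have "\<not> length \<pi> + 1 \<le> \<pi> ! i" if "i < length \<pi>" for i
    using strong_Baxter_nth_interval[OF sb that] by simp
  then have "\<not> blocked \<pi> (length \<pi> + 1)"
    unfolding blocked_def by (metis add_lessD1 less_trans)
  with sb show ?thesis by (simp add: active_sites_eq)
qed

lemma last_mem_interval:
  assumes "strong_Baxter \<pi>" "\<pi> \<noteq> []"
  shows "last \<pi> \<in> {1..length \<pi>}"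
  using strong_Baxter_nth_interval[OF assms(1), of "length \<pi> - 1"] assms(2)
  by (simp add: last_conv_nth)

text \<open>
  A pattern in \<open>\<pi> \<cdot> last \<pi>\<close> that uses the new entry gives one in \<open>\<pi>\<close> that uses the old last entry
  instead, because the two entries have consecutive values.
\<close>

lemma last_mem_active_sites:
  assumes sb: "strong_Baxter \<pi>" and ne: "\<pi> \<noteq> []"
  shows "last \<pi> \<in> active_sites \<pi>"
proof -
  let ?n = "length \<pi>"
  have dist: "distinct \<pi>" using sb by (auto simp: strong_Baxter_def permutations_of_setD)
  have l: "last \<pi> = \<pi> ! (?n - 1)" using ne by (rule last_conv_nth)
  have "\<not> blocked \<pi> (last \<pi>)"
  proof
    assume "blocked \<pi> (last \<pi>)"
    then obtain i j where ij: "i < j" "j + 1 < ?n" and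
      C: "\<pi> ! (j+1) < \<pi> ! i \<and> \<pi> ! i < last \<pi> \<and> last \<pi> \<le> \<pi> ! j \<or>
      \<pi> ! j < last \<pi> \<and> last \<pi> \<le> \<pi> ! i \<and> \<pi> ! i < \<pi> ! (j+1) \<or>
      \<pi> ! (j+1) < last \<pi> \<and> last \<pi> \<le> \<pi> ! i \<and> \<pi> ! i < \<pi> ! j"
      unfolding blocked_def by blast
    \<comment> \<open>If the adjacent pair ended in \<open>last \<pi>\<close>, a value would lie strictly between that value and itself.\<close>
    have "j + 1 \<noteq> ?n - 1" using C l by auto
    then have k: "j + 1 < ?n - 1" "?n - 1 < ?n" using ij by auto
    have "\<pi> ! i \<noteq> \<pi> ! (?n - 1)" "\<pi> ! j \<noteq> \<pi> ! (?n - 1)"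
      using dist ij k by (auto simp: nth_eq_iff_index_eq)
    then show False using sb C ij k unfolding strong_Baxter_def l
      by (metis le_neq_implies_less)
  qed
  then show ?thesis using sb last_mem_interval[OF assms] by (simp add: active_sites_eq)
qed

lemma finite_active_sites [simp]: "finite (active_sites \<pi>)"
  by (rule finite_subset[of _ "{1..length \<pi> + 1}"]) (auto simp: active_sites_def)

lemma active_sites_append_value:
  assumes sb: "strong_Baxter \<pi>" and ne: "\<pi> \<noteq> []" and a: "a \<in> active_sites \<pi>"
  shows "active_sites (append_value \<pi> a) =
    {b. parent_site a b \<in> active_sites \<pi> \<and>
        \<not> (a < last \<pi> \<and> a < b \<and> b \<le> last \<pi> + 1) \<and> \<not> (last \<pi> < b \<and> b < a)}"
proof -
  have a': "a \<in> {1..length \<pi> + 1}" and sb': "strong_Baxter (append_value \<pi> a)"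
    using a by (auto simp: active_sites_def)
  have perm: "\<pi> \<in> permutations_of_set {1..length \<pi>}" using sb by (simp add: strong_Baxter_def)
  have "b \<in> {1..length \<pi> + 2} \<longleftrightarrow> parent_site a b \<in> {1..length \<pi> + 1}" for b
    using a' by (auto simp: parent_site_def)
  then show ?thesis
    unfolding active_sites_eq[OF sb'] active_sites_eq[OF sb]
    using blocked_append_value_iff[OF perm ne a'] by auto
qed

text \<open>
  Since the new last entry is \<open>a\<close>, the label of \<open>\<pi> \<cdot> a\<close> separates its active sites up to \<open>a\<close>, which
  are active sites of \<open>\<pi>\<close>, from those above, which are successors of active sites of \<open>\<pi>\<close>. For
  \<open>a < last \<pi>\<close> the new pair removes from the upper group all sites that do not come from above
  \<open>last \<pi>\<close>; for \<open>a > last \<pi>\<close> it removes from the lower group all sites above \<open>last \<pi>\<close> except \<open>a\<close>.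
  For \<open>a = last \<pi>\<close> nothing is removed, and \<open>a + 1\<close> is an additional upper site.
\<close>

lemma label_append_value_below:
  assumes "strong_Baxter \<pi>" "\<pi> \<noteq> []" "a \<in> active_sites \<pi>" "a < last \<pi>"
  shows "label (append_value \<pi> a) =
    (card {b \<in> active_sites \<pi>. b \<le> a}, card {b \<in> active_sites \<pi>. b > last \<pi>})"
proof -
  let ?A = "active_sites \<pi>" and ?A' = "active_sites (append_value \<pi> a)"
  have "{b \<in> ?A'. b \<le> a} = {b \<in> ?A. b \<le> a}"
    using assms by (auto simp: active_sites_append_value parent_site_def)
  moreover have "{b \<in> ?A'. a < b} = Suc ` {b \<in> ?A. last \<pi> < b}"
  proof (intro set_eqI iffI)
    fix b assume "b \<in> {b \<in> ?A'. a < b}"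
    then have "b = Suc (b - 1)" "b - 1 \<in> {b \<in> ?A. last \<pi> < b}"
      using assms(4) by (auto simp: active_sites_append_value[OF assms(1-3)] parent_site_def)
    then show "b \<in> Suc ` {b \<in> ?A. last \<pi> < b}" by blast
  qed (use assms(4) in \<open>auto simp: active_sites_append_value[OF assms(1-3)] parent_site_def\<close>)
  ultimately show ?thesis by (simp add: label_def card_image)
qed

lemma label_append_value_last:
  assumes "strong_Baxter \<pi>" "\<pi> \<noteq> []" "label \<pi> = (h, k)"
  shows "label (append_value \<pi> (last \<pi>)) = (h, k + 1)"
proof -
  let ?a = "last \<pi>"
  let ?A = "active_sites \<pi>" and ?A' = "active_sites (append_value \<pi> ?a)"
  note a = last_mem_active_sites[OF assms(1,2)]
  have "{b \<in> ?A'. b \<le> ?a} = {b \<in> ?A. b \<le> ?a}"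
    using assms a by (auto simp: active_sites_append_value parent_site_def)
  moreover have "{b \<in> ?A'. ?a < b} = Suc ` insert ?a {b \<in> ?A. ?a < b}"
  proof (intro set_eqI iffI)
    fix b assume "b \<in> {b \<in> ?A'. ?a < b}"
    then have "b = Suc (b - 1)" "b - 1 \<in> insert ?a {b \<in> ?A. ?a < b}"
      by (auto simp: active_sites_append_value[OF assms(1,2) a] parent_site_def)
    then show "b \<in> Suc ` insert ?a {b \<in> ?A. ?a < b}" by blast
  qed (use a in \<open>auto simp: active_sites_append_value[OF assms(1,2) a] parent_site_def\<close>)
  moreover have "card (Suc ` insert ?a {b \<in> ?A. ?a < b}) = card {b \<in> ?A. ?a < b} + 1"
    by (subst card_image) auto
  ultimately show ?thesis using assms(3) by (simp add: label_def)
qed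

lemma label_append_value_above:
  assumes "strong_Baxter \<pi>" "\<pi> \<noteq> []" "a \<in> active_sites \<pi>" "last \<pi> < a"
  shows "label (append_value \<pi> a) =
    (card {b \<in> active_sites \<pi>. b \<le> last \<pi>} + 1, card {b \<in> active_sites \<pi>. b \<ge> a})"
proof -
  let ?A = "active_sites \<pi>" and ?A' = "active_sites (append_value \<pi> a)"
  have "{b \<in> ?A'. b \<le> a} = insert a {b \<in> ?A. b \<le> last \<pi>}"
    using assms by (auto simp: active_sites_append_value parent_site_def)
  moreover have "{b \<in> ?A'. a < b} = Suc ` {b \<in> ?A. a \<le> b}"
  proof (intro set_eqI iffI)
    fix b assume "b \<in> {b \<in> ?A'. a < b}"
    then have "b = Suc (b - 1)" "b - 1 \<in> {b \<in> ?A. a \<le> b}"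
      by (auto simp: active_sites_append_value[OF assms(1-3)] parent_site_def)
    then show "b \<in> Suc ` {b \<in> ?A. a \<le> b}" by blast
  qed (use assms(4) in \<open>auto simp: active_sites_append_value[OF assms(1-3)] parent_site_def\<close>)
  moreover have "a \<notin> {b \<in> ?A. b \<le> last \<pi>}" using assms(4) by auto
  ultimately show ?thesis by (simp add: label_def card_image)
qed

section \<open>The generating tree\<close>

text \<open>
  The labels of the children depend on the rank of \<open>a\<close> among the active sites on its side of
  \<open>last \<pi>\<close>, counted from below or from above; these ranks run through \<open>1, 2, \<dots>\<close>.
\<close>

lemma sum_rank_below:
  fixes A :: "'a::linorder set"
  assumes "finite A"
  shows "(\<Sum>a\<in>A. f (card {b \<in> A. b \<le> a})) = (\<Sum>r=1..card A. f r)"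
  using assms
proof (induction A rule: finite_linorder_max_induct)
  case (insert m A)
  have "m \<notin> A" using insert by auto
  have "{b \<in> insert m A. b \<le> a} = {b \<in> A. b \<le> a}" if "a \<in> A" for a
    using insert that by auto
  moreover have "{b \<in> insert m A. b \<le> m} = insert m A" using insert by auto
  ultimately show ?case using insert \<open>m \<notin> A\<close> by (simp add: add.commute)
qed simp

lemma sum_rank_above:
  fixes A :: "'a::linorder set"
  assumes "finite A"
  shows "(\<Sum>a\<in>A. f (card {b \<in> A. b \<ge> a})) = (\<Sum>r=1..card A. f r)"
  using assms
proof (induction A rule: finite_linorder_min_induct)
  case (insert m A)
  have "m \<notin> A" using insert by auto
  have "{b \<in> insert m A. b \<ge> a} = {b \<in> A. b \<ge> a}" if "a \<in> A" for a
    using insert that by auto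
  moreover have "{b \<in> insert m A. b \<ge> m} = insert m A" using insert by auto
  ultimately show ?case using insert \<open>m \<notin> A\<close> by (simp add: add.commute)
qed simp

text \<open>
  The succession rule
  \<open>(h, k) \<leadsto> (1, k), \<dots>, (h - 1, k), (h, k + 1), (h + 1, 1), \<dots>, (h + 1, k)\<close>,
  stated for sums of an arbitrary function of the label. The site \<open>last \<pi>\<close> gives the middle child and
  is one of the \<open>h\<close> lower sites, which leaves \<open>h - 1\<close> children on the left.
\<close>

lemma sum_active_sites_label:
  fixes f :: "nat \<times> nat \<Rightarrow> 'a::comm_monoid_add"
  assumes sb: "strong_Baxter \<pi>" and ne: "\<pi> \<noteq> []" and hk: "label \<pi> = (h, k)"
  shows "(\<Sum>a\<in>active_sites \<pi>. f (label (append_value \<pi> a))) =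
           (\<Sum>r=1..<h. f (r, k)) + f (h, k + 1) + (\<Sum>r=1..k. f (h + 1, r))"
proof -
  let ?A = "active_sites \<pi>" and ?l = "last \<pi>"
  let ?L = "{a \<in> ?A. a < ?l}" and ?U = "{a \<in> ?A. ?l < a}"
  note l = last_mem_active_sites[OF sb ne]
  have h: "card {a \<in> ?A. a \<le> ?l} = h" and k: "card ?U = k" using hk by (auto simp: label_def)
  have "{a \<in> ?A. a \<le> ?l} = insert ?l ?L" using l by auto
  then have L: "h = Suc (card ?L)" using h by simp
  have split: "?A = insert ?l ?L \<union> ?U" using l by auto
  have "(\<Sum>a\<in>?A. f (label (append_value \<pi> a))) =
        (\<Sum>a\<in>insert ?l ?L. f (label (append_value \<pi> a))) + (\<Sum>a\<in>?U. f (label (append_value \<pi> a)))"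
    by (subst split, rule sum.union_disjoint) auto
  also have "(\<Sum>a\<in>insert ?l ?L. f (label (append_value \<pi> a))) =
      f (h, k + 1) + (\<Sum>a\<in>?L. f (label (append_value \<pi> a)))"
    using label_append_value_last[OF sb ne hk] by simp
  also have "(\<Sum>a\<in>?L. f (label (append_value \<pi> a))) = (\<Sum>a\<in>?L. f (card {b \<in> ?L. b \<le> a}, k))"
  proof (rule sum.cong[OF refl])
    fix a assume a: "a \<in> ?L"
    then have "{b \<in> ?A. b \<le> a} = {b \<in> ?L. b \<le> a}" by auto
    then show "f (label (append_value \<pi> a)) = f (card {b \<in> ?L. b \<le> a}, k)"
      using label_append_value_below[OF sb ne, of a] a k by simp
  qed
  also have "\<dots> = (\<Sum>r=1..<h. f (r, k))"
    using sum_rank_below[of ?L "\<lambda>r. f (r, k)"] L by (simp add: atLeastLessThanSuc_atLeastAtMost)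
  also have "(\<Sum>a\<in>?U. f (label (append_value \<pi> a))) = (\<Sum>a\<in>?U. f (h + 1, card {b \<in> ?U. b \<ge> a}))"
  proof (rule sum.cong[OF refl])
    fix a assume a: "a \<in> ?U"
    then have "{b \<in> ?A. b \<ge> a} = {b \<in> ?U. b \<ge> a}" by auto
    then show "f (label (append_value \<pi> a)) = f (h + 1, card {b \<in> ?U. b \<ge> a})"
      using label_append_value_above[OF sb ne, of a] a h by simp
  qed
  also have "\<dots> = (\<Sum>r=1..k. f (h + 1, r))"
    using sum_rank_above[of ?U "\<lambda>r. f (h + 1, r)"] k by simp
  finally show ?thesis by (simp add: add_ac)
qed

definition strong_Baxter_perms :: "nat \<Rightarrow> nat list set" where
  "strong_Baxter_perms n = {\<pi>. strong_Baxter \<pi> \<and> \<pi> \<noteq> [] \<and> length \<pi> = n}"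

lemma finite_strong_Baxter_perms [simp]: "finite (strong_Baxter_perms n)"
  by (rule finite_subset[of _ "permutations_of_set {1..n}"])
     (auto simp: strong_Baxter_perms_def strong_Baxter_def)

lemma label_ge_1:
  assumes sb: "strong_Baxter \<pi>" and ne: "\<pi> \<noteq> []" and hk: "label \<pi> = (h, k)"
  shows "h \<ge> 1" "k \<ge> 1"
proof -
  have "1 \<in> {a \<in> active_sites \<pi>. a \<le> last \<pi>}"
    using one_mem_active_sites[OF sb] last_mem_interval[OF sb ne] by simp
  then have "0 < card {a \<in> active_sites \<pi>. a \<le> last \<pi>}" unfolding card_gt_0_iff by auto
  then show "h \<ge> 1" using hk by (auto simp: label_def)
  have "length \<pi> + 1 \<in> {a \<in> active_sites \<pi>. a > last \<pi>}"
    using Suc_length_mem_active_sites[OF sb] last_mem_interval[OF sb ne] by simp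
  then have "0 < card {a \<in> active_sites \<pi>. a > last \<pi>}" unfolding card_gt_0_iff by auto
  then show "k \<ge> 1" using hk by (auto simp: label_def)
qed

section \<open>The functional equation\<close>

definition label_monomial :: "'a::comm_semiring_1 \<Rightarrow> 'a \<Rightarrow> nat \<times> nat \<Rightarrow> 'a" where
  "label_monomial y z = (\<lambda>(h, k). y ^ h * z ^ k)"

text \<open>
  Since labels have positive components, no permutation is lost by restricting the defining sum
  to \<open>h, k \<ge> 1\<close>.
\<close>

lemma strong_Baxter_gf_nth:
  "strong_Baxter_gf y z $ n = (\<Sum>\<pi>\<in>strong_Baxter_perms n. label_monomial y z (label \<pi>))"
proof -
  let ?S = "strong_Baxter_perms n"
  have gf: "label_gf h k $ n = card {\<pi> \<in> ?S. label \<pi> = (h, k)}" for h k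
    by (simp add: label_gf_def strong_Baxter_perms_def conj_assoc)
  have pos: "Suc 0 \<le> h" "Suc 0 \<le> k" if "\<pi> \<in> ?S" "label \<pi> = (h, k)" for \<pi> h k
    using label_ge_1[OF _ _ that(2)] that(1) by (simp_all add: strong_Baxter_perms_def)
  have supp: "{(h, k). h \<ge> 1 \<and> k \<ge> 1 \<and> label_gf h k $ n \<noteq> 0} = label ` ?S"
  proof (rule set_eqI)
    fix p :: "nat \<times> nat"
    obtain h k :: nat where p: "p = (h, k)" by fastforce
    have "h \<ge> 1 \<and> k \<ge> 1 \<and> label_gf h k $ n \<noteq> 0 \<longleftrightarrow> (\<exists>\<pi>\<in>?S. label \<pi> = (h, k))"
      using pos by (auto simp: gf card_eq_0_iff)
    then show "p \<in> {(h, k). h \<ge> 1 \<and> k \<ge> 1 \<and> label_gf h k $ n \<noteq> 0} \<longleftrightarrow> p \<in> label ` ?S"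
      unfolding p mem_Collect_eq prod.case image_iff by metis
  qed
  have "(\<Sum>\<pi>\<in>?S. label_monomial y z (label \<pi>)) =
        (\<Sum>p\<in>label ` ?S. \<Sum>\<pi>\<in>{\<pi> \<in> ?S. label \<pi> = p}. label_monomial y z (label \<pi>))"
    by (rule sum.image_gen) simp
  also have "\<dots> = (\<Sum>(h, k)\<in>label ` ?S. of_nat (label_gf h k $ n) * y ^ h * z ^ k)"
    by (intro sum.cong) (auto simp: gf label_monomial_def mult.assoc)
  finally show ?thesis unfolding strong_Baxter_gf_def fps_nth_Abs_fps supp by (rule sym)
qed

lemma strong_Baxter_perms_0: "strong_Baxter_perms 0 = {}"
  by (auto simp: strong_Baxter_perms_def)

lemma strong_Baxter_perms_1: "strong_Baxter_perms 1 = {[1]}"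
  by (auto simp: strong_Baxter_perms_def strong_Baxter_def permutations_of_set_def length_Suc_conv)

lemma label_singleton: "label [1] = (1, 1)"
proof -
  have "strong_Baxter [1]" using strong_Baxter_perms_1 by (auto simp: strong_Baxter_perms_def)
  then have "active_sites [1] = {1, 2}" by (auto simp: active_sites_eq blocked_def)
  then have "{a \<in> active_sites [1]. a \<le> 1} = {1}" "{a \<in> active_sites [1]. a > 1} = {2}" by auto
  then show ?thesis unfolding label_def by simp
qed

lemma bij_betw_append_value:
  assumes "n \<ge> 1"
  shows "bij_betw (\<lambda>(\<pi>, a). append_value \<pi> a)
           (SIGMA \<pi>:strong_Baxter_perms n. active_sites \<pi>) (strong_Baxter_perms (n + 1))"
proof (rule bij_betwI')
  fix p assume "p \<in> (SIGMA \<pi>:strong_Baxter_perms n. active_sites \<pi>)"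
  then show "(case p of (\<pi>, a) \<Rightarrow> append_value \<pi> a) \<in> strong_Baxter_perms (n + 1)"
    by (auto simp: strong_Baxter_perms_def active_sites_def)
next
  fix \<sigma> assume \<sigma>: "\<sigma> \<in> strong_Baxter_perms (n + 1)"
  then have "\<sigma> \<in> permutations_of_set {1..length \<sigma>}" "\<sigma> \<noteq> []"
    by (auto simp only: strong_Baxter_perms_def strong_Baxter_def mem_Collect_eq)
  then obtain \<pi> a where \<pi>: "\<sigma> = append_value \<pi> a" and a: "a \<in> {1..length \<pi> + 1}"
    by (rule permutation_eq_append_value)
  then have "\<pi> \<in> strong_Baxter_perms n" "a \<in> active_sites \<pi>"
    using \<sigma> assms strong_Baxter_append_value_iff[OF a]
    by (auto simp: strong_Baxter_perms_def active_sites_def)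
  with \<pi> show "\<exists>p\<in>(SIGMA \<pi>:strong_Baxter_perms n. active_sites \<pi>).
      \<sigma> = (case p of (\<pi>, a) \<Rightarrow> append_value \<pi> a)"
    by force
qed (auto simp: append_value_inject)

lemma sum_strong_Baxter_perms_Suc:
  fixes f :: "nat \<times> nat \<Rightarrow> 'a::comm_monoid_add"
  assumes "n \<ge> 1"
  shows "(\<Sum>\<sigma>\<in>strong_Baxter_perms (n + 1). f (label \<sigma>)) =
         (\<Sum>\<pi>\<in>strong_Baxter_perms n. case label \<pi> of (h, k) \<Rightarrow>
            (\<Sum>r=1..<h. f (r, k)) + f (h, k + 1) + (\<Sum>r=1..k. f (h + 1, r)))"
proof -
  have "(\<Sum>\<sigma>\<in>strong_Baxter_perms (n + 1). f (label \<sigma>)) =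
        (\<Sum>(\<pi>, a)\<in>(SIGMA \<pi>:strong_Baxter_perms n. active_sites \<pi>). f (label (append_value \<pi> a)))"
    by (subst sum.reindex_bij_betw[OF bij_betw_append_value[OF assms], symmetric])
       (simp add: case_prod_beta)
  also have "\<dots> = (\<Sum>\<pi>\<in>strong_Baxter_perms n. \<Sum>a\<in>active_sites \<pi>. f (label (append_value \<pi> a)))"
    by (subst sum.Sigma) auto
  also have "\<dots> = (\<Sum>\<pi>\<in>strong_Baxter_perms n. case label \<pi> of (h, k) \<Rightarrow>
            (\<Sum>r=1..<h. f (r, k)) + f (h, k + 1) + (\<Sum>r=1..k. f (h + 1, r)))"
    by (intro sum.cong) (auto simp: strong_Baxter_perms_def sum_active_sites_label split: prod.split)
  finally show ?thesis .
qed

lemma geometric_sum_from_1: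
  fixes q :: "'a::comm_ring_1"
  shows "(1 - q) * (\<Sum>r=1..n. q ^ r) = q - q ^ (n + 1)"
  using sum_gp_multiplied[of 1 n q] by (cases n) simp_all

text \<open>
  The succession rule for monomials. Replacing \<open>y\<close> or \<open>z\<close> by 1 turns \<open>y^h z^k\<close> into \<open>z^k\<close> or
  \<open>y^h\<close>; these are what the geometric sums produce apart from \<open>y^h z^k\<close> itself.
\<close>

lemma children_monomial_sum:
  fixes y z :: "'a::comm_ring_1"
  assumes "h \<ge> 1"
  defines "m \<equiv> label_monomial"
  shows "(1 - y) * (1 - z) *
     ((\<Sum>r=1..<h. m y z (r, k)) + m y z (h, k + 1) + (\<Sum>r=1..k. m y z (h + 1, r))) =
     (1 - z) * (y * m 1 z (h, k) - m y z (h, k)) + (1 - y) * (1 - z) * (z * m y z (h, k)) +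
     (1 - y) * (y * z * (m y 1 (h, k) - m y z (h, k)))"
proof -
  obtain d where h: "h = Suc d" using assms by (cases h) auto
  have "(\<Sum>r=1..<h. m y z (r, k)) = (\<Sum>r=1..d. y ^ r) * z ^ k"
    unfolding h m_def label_monomial_def
    by (simp add: sum_distrib_right atLeastLessThanSuc_atLeastAtMost)
  then have lower: "(1 - y) * (\<Sum>r=1..<h. m y z (r, k)) = (y - y ^ h) * z ^ k"
    using geometric_sum_from_1[of y d] by (simp add: h mult.assoc[symmetric])
  have "(\<Sum>r=1..k. m y z (h + 1, r)) = y ^ (h + 1) * (\<Sum>r=1..k. z ^ r)"
    unfolding m_def label_monomial_def by (simp add: sum_distrib_left)
  then have "(1 - z) * (\<Sum>r=1..k. m y z (h + 1, r)) = y ^ (h + 1) * ((1 - z) * (\<Sum>r=1..k. z ^ r))"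
    by (simp only: mult.left_commute)
  then have upper: "(1 - z) * (\<Sum>r=1..k. m y z (h + 1, r)) = y ^ (h + 1) * (z - z ^ (k + 1))"
    by (simp only: geometric_sum_from_1)
  have "(1 - y) * (1 - z) *
     ((\<Sum>r=1..<h. m y z (r, k)) + m y z (h, k + 1) + (\<Sum>r=1..k. m y z (h + 1, r))) =
     (1 - z) * ((1 - y) * (\<Sum>r=1..<h. m y z (r, k))) + (1 - y) * (1 - z) * m y z (h, k + 1) +
     (1 - y) * ((1 - z) * (\<Sum>r=1..k. m y z (h + 1, r)))"
    by (simp add: algebra_simps)
  also have "\<dots> = (1 - z) * (y * m 1 z (h, k) - m y z (h, k)) + (1 - y) * (1 - z) * (z * m y z (h, k)) +
     (1 - y) * (y * z * (m y 1 (h, k) - m y z (h, k)))"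
    unfolding lower upper by (simp add: m_def label_monomial_def algebra_simps)
  finally show ?thesis .
qed

text \<open>
  The coefficient of \<open>x^(m + 1)\<close> collects the children of the permutations of size \<open>m\<close>. The case
  \<open>m = 0\<close> is separate: the permutation of size 1, with label \<open>(1, 1)\<close>, has no parent among the
  nonempty permutations and accounts for the term \<open>xyz\<close>.
\<close>

lemma strong_Baxter_gf_functional_equation:
  fixes y z :: "'a::comm_ring_1"
  defines "F \<equiv> strong_Baxter_gf"
  defines "Y \<equiv> fps_const y" and "Z \<equiv> fps_const z"
  shows "(1 - Y) * (1 - Z) * F y z =
     fps_X * ((1 - Y) * (1 - Z) * (Y * Z) + (1 - Z) * (Y * F 1 z - F y z) +
       (1 - Y) * (1 - Z) * (Z * F y z) + (1 - Y) * (Y * Z * (F y 1 - F y z)))"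
    (is "?L = fps_X * ?R")
proof (rule fps_ext)
  fix n
  have const: "1 - fps_const c = fps_const (1 - c)" for c :: 'a
    using fps_const_sub[of 1 c] by simp
  show "?L $ n = (fps_X * ?R) $ n"
  proof (cases n)
    case 0
    then show ?thesis
      by (simp add: const Y_def Z_def mult.assoc F_def strong_Baxter_gf_nth strong_Baxter_perms_0)
  next
    case (Suc m)
    have R: "(fps_X * ?R) $ n = (if m = 0 then (1 - y) * (1 - z) * (y * z) else 0) +
      (1 - z) * (y * F 1 z $ m - F y z $ m) + (1 - y) * (1 - z) * (z * F y z $ m) +
      (1 - y) * (y * z * (F y 1 $ m - F y z $ m))"
      by (simp add: Suc const Y_def Z_def mult.assoc)
    show ?thesis
    proof (cases "m = 0")
      case True
      then show ?thesis
        unfolding R using Suc strong_Baxter_perms_1 label_singleton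
        by (simp add: const Y_def Z_def mult.assoc F_def strong_Baxter_gf_nth
            strong_Baxter_perms_0 label_monomial_def)
    next
      case False
      then have "m \<ge> 1" by simp
      let ?S = "strong_Baxter_perms m"
      let ?m = "\<lambda>u v \<pi>. label_monomial u v (label \<pi>)"
      have "?L $ n = (1 - y) * (1 - z) * F y z $ (m + 1)"
        by (simp add: Suc const Y_def Z_def mult.assoc)
      also have "\<dots> = (\<Sum>\<pi>\<in>?S. (1 - z) * (y * ?m 1 z \<pi> - ?m y z \<pi>) +
            (1 - y) * (1 - z) * (z * ?m y z \<pi>) + (1 - y) * (y * z * (?m y 1 \<pi> - ?m y z \<pi>)))"
        unfolding F_def strong_Baxter_gf_nth
          sum_strong_Baxter_perms_Suc[OF \<open>m \<ge> 1\<close>] sum_distrib_left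
      proof (rule sum.cong[OF refl])
        fix \<pi> assume "\<pi> \<in> ?S"
        obtain h k where hk: "label \<pi> = (h, k)" by fastforce
        have "h \<ge> 1" using label_ge_1[OF _ _ hk] \<open>\<pi> \<in> ?S\<close> by (simp add: strong_Baxter_perms_def)
        from children_monomial_sum[OF this, of y z k]
        show "(1 - y) * (1 - z) * (case label \<pi> of (h, k) \<Rightarrow>
               (\<Sum>r=1..<h. label_monomial y z (r, k)) + label_monomial y z (h, k + 1) +
               (\<Sum>r=1..k. label_monomial y z (h + 1, r))) =
             (1 - z) * (y * ?m 1 z \<pi> - ?m y z \<pi>) +
            (1 - y) * (1 - z) * (z * ?m y z \<pi>) + (1 - y) * (y * z * (?m y 1 \<pi> - ?m y z \<pi>))"
          unfolding hk prod.case .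
      qed
      also have "\<dots> = (fps_X * ?R) $ n"
        unfolding R unfolding F_def strong_Baxter_gf_nth using False
        by (simp add: sum.distrib sum_subtractf sum_distrib_left[symmetric])
      finally show ?thesis .
    qed
  qed
qed

theorem proposition24:
  shows "let x = to_fract (fps_X :: int poly poly fps);
             y = to_fract (fps_const var_y);
             z = to_fract (fps_const var_z);
             I = (\<lambda>u v. to_fract (strong_Baxter_gf u v))
         in I var_y var_z =
              x * y * z
              + x / (1 - y) * (y * I 1 var_z - I var_y var_z)
              + x * z * I var_y var_z
              + x * y * z / (1 - z) * (I var_y 1 - I var_y var_z)"
proof -
  define x where "x = to_fract (fps_X :: int poly poly fps)"
  define y where "y = to_fract (fps_const var_y)"
  define z where "z = to_fract (fps_const var_z)"
  define I where "I = (\<lambda>u v. to_fract (strong_Baxter_gf u v :: int poly poly fps))"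
  have "var_y \<noteq> 1" "var_z \<noteq> 1" by (simp_all add: var_y_def var_z_def one_pCons)
  then have "y \<noteq> 1" "z \<noteq> 1"
    unfolding y_def z_def by (metis fps_const_eq_1_iff to_fract_1 to_fract_eq_iff)+
  have clear_denominators: "J = x * y * z + x / p * A + x * z * J + x * y * z / q * B"
    if "p \<noteq> 0" "q \<noteq> 0"
      and eq: "p * q * J = x * (p * q * (y * z) + q * A + p * q * (z * J) + p * (y * z * B))"
    for p q A B J :: "int poly poly fps fract"
  proof -
    have "p * q * (x * y * z + x / p * A + x * z * J + x * y * z / q * B) = p * q * J"
      unfolding eq using that(1,2) by (simp add: distrib_left mult_ac)
    then show ?thesis using that(1,2) by simp
  qed
  have "(1 - y) * (1 - z) * I var_y var_z =
     x * ((1 - y) * (1 - z) * (y * z) + (1 - z) * (y * I 1 var_z - I var_y var_z) +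
       (1 - y) * (1 - z) * (z * I var_y var_z) + (1 - y) * (y * z * (I var_y 1 - I var_y var_z)))"
    using arg_cong[OF strong_Baxter_gf_functional_equation[of var_y var_z], of to_fract]
    unfolding x_def y_def z_def I_def
    by (simp only: to_fract_mult to_fract_add to_fract_diff to_fract_1)
  then have "I var_y var_z =
              x * y * z
              + x / (1 - y) * (y * I 1 var_z - I var_y var_z)
              + x * z * I var_y var_z
              + x * y * z / (1 - z) * (I var_y 1 - I var_y var_z)"
    using clear_denominators[of "1 - y" "1 - z"] \<open>y \<noteq> 1\<close> \<open>z \<noteq> 1\<close> by simp
  then show ?thesis unfolding Let_def x_def y_def z_def I_def .
qed

end
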